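(* Let $p$ be a prime greater than $3$. Then $$\sum_{n=0}^{p-1}\big(9(2n+1)^5-4(2n+1)^3-(2n+1)\big)A_n^2\equiv -20p^4+24p^6+\frac{16}3p^7B_{p-3}\pmod{p^8}.$$
   Context: $A_n=\sum_{k=0}^n\binom nk^2\binom{n+k}k^2$ are the Apéry numbers. $\{B_n\}$ are the Bernoulli numbers given by $B_0=1$ and $\sum_{k=0}^{n-1}\binom nkB_k=0$ for $n\ge 2$. A congruence $\alpha\equiv\beta\pmod{p^m}$ between rational numbers with denominators prime to $p$ means that $(\alpha-\beta)/p^m$ is a rational number with denominator prime to $p$. *)

theory Defs
  imports Complex_Main "HOL-Computational_Algebra.Primes"
begin

definition apery :: "nat \<Rightarrow> nat" where
  "apery n = (\<Sum>k=0..n. (n choose k)\<^sup>2 * ((n + k) choose k)\<^sup>2)"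

(* The recurrence "sum of (n choose k) B_k over 0 <= k < n vanishes for n >= 2", solved for its
   last term B_(n-1) and re-indexed; the recurrence itself is bernoulli_recurrence below. *)
fun bernoulli :: "nat \<Rightarrow> rat" where
  "bernoulli n = (if n = 0 then 1
     else - (\<Sum>k<n. of_nat (Suc n choose k) * bernoulli k) / of_nat (Suc n))"

declare bernoulli.simps [simp del]

lemma bernoulli_0: "bernoulli 0 = 1"
  by (simp add: bernoulli.simps)

lemma bernoulli_recurrence:
  assumes "n \<ge> 2"
  shows "(\<Sum>k=0..n-1. of_nat (n choose k) * bernoulli k) = 0"
proof -
  obtain m where m: "n = Suc m" "m > 0"
    using assms by (cases n) auto
  have "bernoulli m = - (\<Sum>k<m. of_nat (Suc m choose k) * bernoulli k) / of_nat (Suc m)"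
    using m by (subst bernoulli.simps) simp
  then have "of_nat (Suc m) * bernoulli m = - (\<Sum>k<m. of_nat (Suc m choose k) * bernoulli k)"
    by (simp del: of_nat_Suc)
  then have "(\<Sum>k<Suc m. of_nat (Suc m choose k) * bernoulli k) = 0"
    by (simp del: of_nat_Suc binomial_Suc_Suc)
  moreover have "{0..n-1} = {..<Suc m}"
    using m by auto
  ultimately show ?thesis
    using m by simp
qed

definition denom_prime_to :: "nat \<Rightarrow> rat \<Rightarrow> bool" where
  "denom_prime_to p x \<longleftrightarrow> coprime (snd (quotient_of x)) (int p)"

(* The third condition is the congruence of a and b modulo p^m; the first two say that the
   congruence is only meant between rationals whose denominators are prime to p. *)
definition rat_cong_ppow :: "nat \<Rightarrow> nat \<Rightarrow> rat \<Rightarrow> rat \<Rightarrow> bool" where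
  "rat_cong_ppow p m a b \<longleftrightarrow>
     denom_prime_to p a \<and> denom_prime_to p b \<and> denom_prime_to p ((a - b) / of_nat p ^ m)"

end

theory Submission
  imports Defs "HOL-Number_Theory.Residues"
begin

text \<open>
  Write \<open>a = A\<^sub>n\<close> and \<open>b = A\<^sub>n\<^sub>-\<^sub>1\<close>. The polynomial weight is chosen so that the sum telescopes: by
  Apery's three-term recurrence the quadratic form
  \<open>n^6 (17/3 a b - (a^2 + b^2)/6) - 4 n^4 a b\<close>
  grows from \<open>n\<close> to \<open>n + 1\<close> by exactly the \<open>n\<close>-th summand (\<open>weighted_apery_square_sum\<close>). So the
  whole sum is this form at \<open>n = p\<close>. Its factor \<open>p^4\<close> reduces a congruence modulo \<open>p^8\<close> to the values
  of \<open>A\<^sub>p\<close> and \<open>A\<^sub>p\<^sub>-\<^sub>1\<close> modulo \<open>p^4\<close>.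
  
  Let \<open>H\<close> be the sum of \<open>1/k^2\<close> over \<open>0 < k < p\<close>. The products \<open>C(n,k) C(n+k,k)\<close> factor into terms
  \<open>n^2/j^2 - 1\<close>, both for \<open>n = p\<close> and, up to one changed sign, for \<open>n = p - 1\<close>. Since these products
  are even in \<open>p\<close>, expanding them yields \<open>A\<^sub>p = 5 - 7 p^2 H\<close> and \<open>A\<^sub>p\<^sub>-\<^sub>1 = 1 + p^2 H\<close> modulo \<open>p^4\<close>
  (\<open>apery_p_cong\<close>, \<open>apery_pred_p_cong\<close>); the cubic harmonic sums that occur vanish modulo \<open>p\<close>.
  
  It remains to see that \<open>H = 2/3 p B\<^sub>p\<^sub>-\<^sub>3\<close> modulo \<open>p^2\<close> (\<open>harmonic_sum_2_p_cong\<close>). Let \<open>H\<^sub>k\<close> denote the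
  harmonic numbers. The alternating sum of \<open>C(n,k)/k^2\<close> equals the sum of \<open>H\<^sub>k/k\<close>, and for \<open>n = p - 1\<close>
  the two sides are, modulo \<open>p^2\<close>, \<open>p T - H\<close> with \<open>T\<close> the sum of \<open>H\<^sub>k/k^2\<close>, and \<open>H/2\<close>.
  So \<open>3 H = 2 p T\<close>, which leaves \<open>T\<close> to be found modulo \<open>p\<close> only. There \<open>1/j = j^(p-2)\<close>, and Faulhaber's
  formula expresses \<open>H\<^sub>k\<close> through Bernoulli numbers, of which summation over \<open>k\<close> selects \<open>B\<^sub>p\<^sub>-\<^sub>3\<close>. This way
  only Bernoulli numbers of index below \<open>p - 1\<close> occur, which the defining recurrence shows to be
  \<open>p\<close>-integral, and Kummer's congruences are avoided.
\<close>

section \<open>The weighted square sum telescopes\<close>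

definition apery_term :: "nat \<Rightarrow> nat \<Rightarrow> rat" where
  "apery_term n k = of_nat (n choose k) * of_nat ((n + k) choose k)"

lemma of_nat_apery:
  assumes "n \<le> N"
  shows "of_nat (apery n) = (\<Sum>k\<le>N. (apery_term n k)\<^sup>2)"
proof -
  have "of_nat (apery n) = (\<Sum>k\<le>n. (apery_term n k)\<^sup>2)"
    by (simp add: apery_def apery_term_def power_mult_distrib atLeast0AtMost)
  also have "\<dots> = (\<Sum>k\<le>N. (apery_term n k)\<^sup>2)"
    using assms by (intro sum.mono_neutral_left) (auto simp: apery_term_def)
  finally show ?thesis .
qed

lemma apery_term_eq_fact:
  assumes "k \<le> n"
  shows "apery_term n k = fact (n + k) / (fact (n - k) * (fact k)\<^sup>2)"
  using assms by (simp add: apery_term_def binomial_fact power2_eq_square)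

lemma apery_term_Suc_right:
  "apery_term n (Suc k) * of_nat (Suc k) ^ 2 = apery_term n k * (of_nat n + of_nat k + 1) * (of_nat n - of_nat k)"
proof (cases "k < n")
  case True
  then obtain d where n: "n = k + Suc d"
    using less_imp_Suc_add by auto
  have "apery_term n (Suc k) = (of_nat (n + k + 1) * fact (n + k)) / (fact d * (of_nat (Suc k) * fact k)\<^sup>2)"
    by (subst apery_term_eq_fact) (simp_all add: n)
  moreover have "apery_term n k = fact (n + k) / (of_nat (Suc d) * fact d * (fact k)\<^sup>2)"
    by (subst apery_term_eq_fact) (simp_all add: n)
  moreover have "(of_nat n - of_nat k :: rat) = of_nat (Suc d)"
    by (simp add: n)
  ultimately show ?thesis
    by (simp add: power_mult_distrib del: of_nat_Suc)
next
  case False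
  then show ?thesis by (cases "k = n") (auto simp: apery_term_def binomial_eq_0)
qed

lemma apery_term_0: "apery_term n 0 = 1"
  by (simp add: apery_term_def)

text \<open>
  All the terms that enter the recurrence at \<open>(n, k + 1)\<close> are polynomial multiples of one number.
  The factors \<open>n - k\<close> and \<open>n - k - 1\<close> vanish where the binomial coefficients do, so that the
  boundary columns \<open>k = n - 1\<close> and \<open>k = n\<close> obey the same formulas.
\<close>

lemma apery_term_neighbours:
  assumes "1 \<le> n" "k \<le> n"
  defines "s \<equiv> fact (n + k) / (fact (n - k) * (fact (Suc k))\<^sup>2) :: rat"
  shows "apery_term n k = (of_nat k + 1)\<^sup>2 * s"
    and "apery_term n (Suc k) = (of_nat n + of_nat k + 1) * (of_nat n - of_nat k) * s"
    and "apery_term (n + 1) (Suc k) = (of_nat n + of_nat k + 2) * (of_nat n + of_nat k + 1) * s"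
    and "apery_term (n - 1) (Suc k) = (of_nat n - of_nat k - 1) * (of_nat n - of_nat k) * s"
proof -
  show 1: "apery_term n k = (of_nat k + 1)\<^sup>2 * s"
    using assms(2) unfolding s_def apery_term_eq_fact[OF assms(2)]
    by (simp add: power_mult_distrib add.commute del: of_nat_Suc) (simp add: add.commute)
  show "apery_term n (Suc k) = (of_nat n + of_nat k + 1) * (of_nat n - of_nat k) * s"
    using apery_term_Suc_right[of n k] 1 by (simp add: add.commute)
  show "apery_term (n + 1) (Suc k) = (of_nat n + of_nat k + 2) * (of_nat n + of_nat k + 1) * s"
    using assms(2) unfolding s_def
    by (subst apery_term_eq_fact) (simp_all add: add_ac)
  show "apery_term (n - 1) (Suc k) = (of_nat n - of_nat k - 1) * (of_nat n - of_nat k) * s"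
  proof (cases "k < n - 1")
    case True
    then obtain d where n: "n = k + 2 + d"
      using that[of "n - (k + 2)"] by simp
    have pred: "apery_term (n - 1) (Suc k) = fact (n + k) / (fact d * (fact (Suc k))\<^sup>2)"
      by (subst apery_term_eq_fact) (simp_all add: n del: fact_Suc)
    have fact: "fact (n - k) = of_nat (d + 2) * of_nat (d + 1) * (fact d :: rat)"
      by (simp add: n mult.assoc)
    have diff: "of_nat n - of_nat k = (of_nat (d + 2) :: rat)" "of_nat (d + 2) - 1 = (of_nat (d + 1) :: rat)"
      by (simp_all add: n)
    show ?thesis
      unfolding s_def pred fact diff
      by (simp del: of_nat_add of_nat_Suc fact_Suc add_2_eq_Suc' add_Suc_right One_nat_def)
  next
    case False
    then have "k = n \<or> n = k + 1" using assms by auto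
    then show ?thesis using assms(1) by (auto simp: apery_term_def)
  qed
qed

text \<open>
  This is Zeilberger's certificate for the Apery recurrence: the recurrence applied to the summand
  is a difference in \<open>k\<close>. After division by the square of the common factor of the previous lemma
  it is a polynomial identity.
\<close>

lemma apery_term_certificate:
  fixes n :: nat
  assumes "1 \<le> n" "k \<le> n"
  defines "x \<equiv> of_nat n :: rat" and "y \<equiv> of_nat k :: rat"
  defines "c \<equiv> \<lambda>y. 4 * (2 * x + 1) * (y * (2 * y + 1) - (2 * x + 1)\<^sup>2)"
  shows "(x + 1) ^ 3 * (apery_term (n + 1) (Suc k))\<^sup>2
      - (2 * x + 1) * (17 * x\<^sup>2 + 17 * x + 5) * (apery_term n (Suc k))\<^sup>2
      + x ^ 3 * (apery_term (n - 1) (Suc k))\<^sup>2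
    = c (y + 1) * (apery_term n (Suc k))\<^sup>2 - c y * (apery_term n k)\<^sup>2"
proof -
  have certificate: "(x + 1) ^ 3 * ((x + y + 2) * (x + y + 1) * s)\<^sup>2
      - (2 * x + 1) * (17 * x\<^sup>2 + 17 * x + 5) * ((x + y + 1) * (x - y) * s)\<^sup>2
      + x ^ 3 * ((x - y - 1) * (x - y) * s)\<^sup>2
    = c (y + 1) * ((x + y + 1) * (x - y) * s)\<^sup>2 - c y * ((y + 1)\<^sup>2 * s)\<^sup>2" for s
    unfolding c_def by (simp add: algebra_simps eval_nat_numeral)
  show ?thesis
    unfolding apery_term_neighbours[OF assms(1,2)] x_def[symmetric] y_def[symmetric]
    by (rule certificate)
qed

text \<open>
  At \<open>n = 0\<close> the truncated index \<open>n - 1\<close> is harmless, because its coefficient \<open>n^3\<close> vanishes.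
\<close>

lemma apery_recurrence:
  defines "x \<equiv> \<lambda>n. of_nat n :: rat"
  shows "(x n + 1) ^ 3 * of_nat (apery (n + 1))
    = (2 * x n + 1) * (17 * (x n)\<^sup>2 + 17 * x n + 5) * of_nat (apery n) - (x n) ^ 3 * of_nat (apery (n - 1))"
proof (cases "n = 0")
  case True
  then show ?thesis by (simp add: x_def apery_def)
next
  case False
  define y where "y = x n"
  define c where "c = (\<lambda>k. 4 * (2 * y + 1) * (of_nat k * (2 * of_nat k + 1) - (2 * y + 1)\<^sup>2))"
  define g where "g = (\<lambda>k. (y + 1) ^ 3 * (apery_term (n + 1) k)\<^sup>2
      - (2 * y + 1) * (17 * y\<^sup>2 + 17 * y + 5) * (apery_term n k)\<^sup>2
      + y ^ 3 * (apery_term (n - 1) k)\<^sup>2)"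
  have g_Suc: "g (Suc k) = c (Suc k) * (apery_term n (Suc k))\<^sup>2 - c k * (apery_term n k)\<^sup>2" if "k \<le> n" for k
    using apery_term_certificate[of n k] False that
    by (simp add: g_def c_def y_def x_def add.commute)
  \<comment> \<open>The sum of the certificate identities telescopes, and \<open>apery_term n (n + 1) = 0\<close>.\<close>
  have "sum g {..m} = c m * (apery_term n m)\<^sup>2" if "m \<le> n + 1" for m
    using that
  proof (induction m)
    case 0
    show ?case by (simp add: g_def c_def apery_term_0 algebra_simps eval_nat_numeral)
  qed (simp add: g_Suc)
  from this[of "n + 1"] have "sum g {..n + 1} = 0"
    by (simp add: apery_term_def)
  moreover have "sum g {..n + 1} = (y + 1) ^ 3 * of_nat (apery (n + 1))
      - (2 * y + 1) * (17 * y\<^sup>2 + 17 * y + 5) * of_nat (apery n)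
      + y ^ 3 * of_nat (apery (n - 1))"
    by (subst (1 2 3) of_nat_apery[of _ "n + 1"])
       (simp_all add: g_def sum.distrib sum_subtractf sum_distrib_left del: sum.atMost_Suc)
  ultimately show ?thesis by (simp add: y_def)
qed

text \<open>
  In terms of \<open>u = (n+1)^3 A\<^sub>n\<^sub>+\<^sub>1\<close> and \<open>v = n^3 A\<^sub>n\<^sub>-\<^sub>1\<close> the right-hand side depends polynomially on
  \<open>v\<close> at \<open>n\<close> and on \<open>u\<close> at \<open>n + 1\<close>. As the recurrence makes \<open>u + v\<close> a multiple of \<open>A\<^sub>n\<close>, the terms with
  \<open>v\<close> and \<open>v^2\<close> cancel in the difference and only a multiple of \<open>A\<^sub>n\<^sup>2\<close> remains.
\<close>

lemma weighted_apery_square_sum: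
  fixes n :: nat
  defines "x \<equiv> of_nat n :: rat" and "a \<equiv> of_nat (apery n) :: rat" and "b \<equiv> of_nat (apery (n - 1)) :: rat"
  shows "(\<Sum>k<n. (9 * (2 * of_nat k + 1) ^ 5 - 4 * (2 * of_nat k + 1) ^ 3 - (2 * of_nat k + 1)) * of_nat (apery k) ^ 2)
    = x ^ 6 * (17 / 3 * a * b - (a\<^sup>2 + b\<^sup>2) / 6) - 4 * x ^ 4 * a * b"
  unfolding x_def a_def b_def
proof (induction n)
  case 0
  show ?case by simp
next
  case (Suc n)
  define x a where "x = (of_nat n :: rat)" and "a = (of_nat (apery n) :: rat)"
  define u v where "u = (x + 1) ^ 3 * of_nat (apery (n + 1))" and "v = x ^ 3 * of_nat (apery (n - 1))"
  have u: "u = (2 * x + 1) * (17 * x\<^sup>2 + 17 * x + 5) * a - v"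
    using apery_recurrence[of n] by (simp add: u_def v_def x_def a_def)
  have *: "x ^ 6 * (17 / 3 * a * b - (a\<^sup>2 + b\<^sup>2) / 6) - 4 * x ^ 4 * a * b
      = 17 / 3 * x ^ 3 * a * (x ^ 3 * b) - (x ^ 6 * a\<^sup>2 + (x ^ 3 * b)\<^sup>2) / 6 - 4 * x * a * (x ^ 3 * b)" for x a b :: rat
    by (simp add: field_simps eval_nat_numeral)
  have l: "x ^ 6 * (17 / 3 * a * of_nat (apery (n - 1)) - (a\<^sup>2 + (of_nat (apery (n - 1)))\<^sup>2) / 6) - 4 * x ^ 4 * a * of_nat (apery (n - 1))
    = 17 / 3 * x ^ 3 * a * v - (x ^ 6 * a\<^sup>2 + v\<^sup>2) / 6 - 4 * x * a * v"
    unfolding * v_def ..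
  have r: "(x + 1) ^ 6 * (17 / 3 * of_nat (apery (n + 1)) * a - ((of_nat (apery (n + 1)))\<^sup>2 + a\<^sup>2) / 6) - 4 * (x + 1) ^ 4 * of_nat (apery (n + 1)) * a
    = 17 / 3 * (x + 1) ^ 3 * a * u - ((x + 1) ^ 6 * a\<^sup>2 + u\<^sup>2) / 6 - 4 * (x + 1) * a * u"
    using *[of "x + 1" a "of_nat (apery (n + 1))"] by (simp add: u_def mult_ac add_ac)
  have "17 / 3 * x ^ 3 * a * v - (x ^ 6 * a\<^sup>2 + v\<^sup>2) / 6 - 4 * x * a * v
      + (9 * (2 * x + 1) ^ 5 - 4 * (2 * x + 1) ^ 3 - (2 * x + 1)) * a ^ 2
    = 17 / 3 * (x + 1) ^ 3 * a * u - ((x + 1) ^ 6 * a\<^sup>2 + u\<^sup>2) / 6 - 4 * (x + 1) * a * u"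
    unfolding u by (simp add: field_simps eval_nat_numeral)
  then show ?case
    using Suc l r by (simp add: x_def a_def add.commute)
qed

section \<open>Congruences between rationals modulo prime powers\<close>

lemma denom_prime_to_iff:
  assumes "prime p"
  shows "denom_prime_to p x \<longleftrightarrow> (\<exists>a b. \<not> int p dvd b \<and> x = of_int a / of_int b)"
proof
  assume "denom_prime_to p x"
  then have "\<not> int p dvd snd (quotient_of x)"
    using assms unfolding denom_prime_to_def
    by (metis coprime_common_divisor dvd_refl not_prime_unit prime_int_nat_transfer prime_nat_int_transfer)
  moreover have "x = of_int (fst (quotient_of x)) / of_int (snd (quotient_of x))"
    by (rule quotient_of_div) simp
  ultimately show "\<exists>a b. \<not> int p dvd b \<and> x = of_int a / of_int b"
    by blast
next
  assume "\<exists>a b. \<not> int p dvd b \<and> x = of_int a / of_int b"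
  then obtain a b where b: "\<not> int p dvd b" and x: "x = of_int a / of_int b"
    by blast
  obtain n d where nd: "quotient_of x = (n, d)"
    by (cases "quotient_of x") auto
  have "b \<noteq> 0" "d \<noteq> 0"
    using b quotient_of_denom_pos[OF nd] by auto
  then have "(of_int (n * b) :: rat) = of_int (a * d)"
    using quotient_of_div[OF nd] x by (simp add: field_simps)
  then have "d dvd n * b"
    by (simp only: of_int_eq_iff) simp
  then have "d dvd b"
    using quotient_of_coprime[OF nd] by (simp add: coprime_dvd_mult_right_iff coprime_commute)
  then have "\<not> int p dvd d"
    using b dvd_trans by blast
  then show "denom_prime_to p x"
    using assms using prime_imp_coprime[of "int p" d] by (simp add: denom_prime_to_def nd coprime_commute)
qed

locale prime_modulus =
  fixes p :: nat
  assumes prime_p: "prime p"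
begin

abbreviation p_integral :: "rat \<Rightarrow> bool" where
  "p_integral \<equiv> denom_prime_to p"

lemma p_integral_of_int: "p_integral (of_int a)"
  unfolding denom_prime_to_iff[OF prime_p]
  using prime_p by (intro exI[of _ a] exI[of _ 1]) (auto simp: prime_gt_1_nat)

lemma p_integral_of_nat: "p_integral (of_nat a)"
  using p_integral_of_int[of "int a"] by simp

lemma p_integral_numeral: "p_integral 0" "p_integral 1" "p_integral (numeral n)"
  using p_integral_of_nat[of 0] p_integral_of_nat[of 1] p_integral_of_nat[of "numeral n"] by simp_all

lemma p_integral_uminus: "p_integral x \<Longrightarrow> p_integral (- x)"
  unfolding denom_prime_to_iff[OF prime_p] by (metis minus_divide_left of_int_minus)

lemma p_integral_add:
  assumes "p_integral x" "p_integral y"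
  shows "p_integral (x + y)"
proof -
  obtain a b c d where *: "\<not> int p dvd b" "\<not> int p dvd d"
      and xy: "x = of_int a / of_int b" "y = of_int c / of_int d"
    using assms unfolding denom_prime_to_iff[OF prime_p] by blast
  have "b \<noteq> 0" "d \<noteq> 0" using * by auto
  then have "x + y = of_int (a * d + c * b) / of_int (b * d)"
    by (simp add: xy field_simps)
  moreover have "\<not> int p dvd b * d"
    using * prime_p by (simp add: prime_dvd_mult_iff)
  ultimately show ?thesis
    unfolding denom_prime_to_iff[OF prime_p] by blast
qed

lemma p_integral_mult:
  assumes "p_integral x" "p_integral y"
  shows "p_integral (x * y)"
proof -
  obtain a b c d where *: "\<not> int p dvd b" "\<not> int p dvd d"
      and xy: "x = of_int a / of_int b" "y = of_int c / of_int d"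
    using assms unfolding denom_prime_to_iff[OF prime_p] by blast
  have "x * y = of_int (a * c) / of_int (b * d)"
    by (simp add: xy)
  moreover have "\<not> int p dvd b * d"
    using * prime_p by (simp add: prime_dvd_mult_iff)
  ultimately show ?thesis
    unfolding denom_prime_to_iff[OF prime_p] by blast
qed

lemma p_integral_diff: "p_integral x \<Longrightarrow> p_integral y \<Longrightarrow> p_integral (x - y)"
  using p_integral_add[of x "- y"] p_integral_uminus[of y] by simp

lemma p_integral_power: "p_integral x \<Longrightarrow> p_integral (x ^ n)"
  by (induction n) (auto intro: p_integral_mult p_integral_numeral)

lemma p_integral_sum: "(\<And>i. i \<in> I \<Longrightarrow> p_integral (f i)) \<Longrightarrow> p_integral (sum f I)"
  by (induction I rule: infinite_finite_induct) (auto intro: p_integral_add p_integral_numeral)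

lemma p_integral_inverse_of_nat: "0 < k \<Longrightarrow> k < p \<Longrightarrow> p_integral (1 / of_nat k)"
  unfolding denom_prime_to_iff[OF prime_p]
  by (intro exI[of _ 1] exI[of _ "int k"]) (auto dest: nat_dvd_not_less)

lemma p_integral_divide_of_nat: "p_integral x \<Longrightarrow> 0 < k \<Longrightarrow> k < p \<Longrightarrow> p_integral (x / of_nat k)"
  using p_integral_mult[OF _ p_integral_inverse_of_nat] by simp

lemma p_integral_divide_of_nat_power:
  "p_integral x \<Longrightarrow> 0 < k \<Longrightarrow> k < p \<Longrightarrow> p_integral (x / of_nat k ^ n)"
  using p_integral_mult[OF _ p_integral_power[OF p_integral_inverse_of_nat], of x k n]
  by (simp add: power_one_over field_simps)

lemmas p_integral_intros = p_integral_of_int p_integral_of_nat p_integral_numeral p_integral_uminus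
  p_integral_add p_integral_mult p_integral_diff p_integral_power p_integral_sum
  p_integral_divide_of_nat p_integral_divide_of_nat_power

text \<open>
  The congruence carries the integrality of both sides with it, which is what makes it compatible
  with multiplication. In the notation the exponent \<open>m\<close> is an argument, whereas \<open>p\<close> is a fixed token
  that stands for the prime of the locale.
\<close>

abbreviation p_cong :: "rat \<Rightarrow> rat \<Rightarrow> nat \<Rightarrow> bool"  ("(_ \<approx> _ '(p^_'))" [51, 51, 0] 50) where
  "a \<approx> b (p^m) \<equiv> rat_cong_ppow p m a b"

lemma p_congI:
  assumes "a = b + of_nat p ^ m * c" "p_integral b" "p_integral c"
  shows "a \<approx> b (p^m)"
  using assms prime_p by (auto simp: rat_cong_ppow_def intro!: p_integral_intros)

lemma p_congE:
  assumes "a \<approx> b (p^m)"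
  obtains c where "a = b + of_nat p ^ m * c" "p_integral a" "p_integral b" "p_integral c"
  using assms prime_p that[of "(a - b) / of_nat p ^ m"] by (auto simp: rat_cong_ppow_def)

lemma p_cong_refl: "p_integral a \<Longrightarrow> a \<approx> a (p^m)"
  by (rule p_congI[of _ _ _ 0]) (auto intro: p_integral_intros)

lemma p_cong_sym: "a \<approx> b (p^m) \<Longrightarrow> b \<approx> a (p^m)"
  by (erule p_congE, rule p_congI[of _ _ _ "- c" for c]) (auto intro: p_integral_intros)

lemma p_cong_trans [trans]:
  assumes "a \<approx> b (p^m)" "b \<approx> c (p^m)"
  shows "a \<approx> c (p^m)"
proof -
  obtain u v where "a = b + of_nat p ^ m * u" "b = c + of_nat p ^ m * v" "p_integral u" "p_integral v" "p_integral c"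
    using assms by (meson p_congE)
  then show ?thesis
    by (intro p_congI[of _ _ _ "u + v"]) (auto simp: algebra_simps intro: p_integral_intros)
qed

lemma p_cong_add:
  assumes "a \<approx> b (p^m)" "c \<approx> d (p^m)"
  shows "a + c \<approx> b + d (p^m)"
proof -
  obtain u v where "a = b + of_nat p ^ m * u" "c = d + of_nat p ^ m * v" "p_integral u" "p_integral v"
      "p_integral b" "p_integral d"
    using assms by (meson p_congE)
  then show ?thesis
    by (intro p_congI[of _ _ _ "u + v"]) (auto simp: algebra_simps intro: p_integral_intros)
qed

lemma p_cong_mult:
  assumes "a \<approx> b (p^m)" "c \<approx> d (p^m)"
  shows "a * c \<approx> b * d (p^m)"
proof -
  obtain u v where *: "a = b + of_nat p ^ m * u" "c = d + of_nat p ^ m * v" "p_integral u" "p_integral v"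
      "p_integral b" "p_integral d" "p_integral c"
    using assms by (meson p_congE)
  have "a * c = b * d + of_nat p ^ m * (u * d + b * v + of_nat p ^ m * (u * v))"
    unfolding * by (simp add: algebra_simps)
  then show ?thesis
    by (rule p_congI) (auto intro!: p_integral_intros *)
qed

lemma p_cong_mult_left: "p_integral c \<Longrightarrow> a \<approx> b (p^m) \<Longrightarrow> c * a \<approx> c * b (p^m)"
  by (rule p_cong_mult[OF p_cong_refl])

lemma p_cong_mult_right: "p_integral c \<Longrightarrow> a \<approx> b (p^m) \<Longrightarrow> a * c \<approx> b * c (p^m)"
  by (rule p_cong_mult[OF _ p_cong_refl])

lemma p_cong_diff:
  assumes "a \<approx> b (p^m)" "c \<approx> d (p^m)"
  shows "a - c \<approx> b - d (p^m)"
proof -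
  have "a + (- 1) * c \<approx> b + (- 1) * d (p^m)"
    by (intro p_cong_add p_cong_mult_left assms p_integral_intros)
  then show ?thesis by simp
qed

lemma p_cong_power: "a \<approx> b (p^m) \<Longrightarrow> a ^ n \<approx> b ^ n (p^m)"
  by (induction n) (auto intro: p_cong_mult p_cong_refl p_integral_intros)

lemma p_cong_sum: "(\<And>i. i \<in> I \<Longrightarrow> f i \<approx> g i (p^m)) \<Longrightarrow> sum f I \<approx> sum g I (p^m)"
  by (induction I rule: infinite_finite_induct) (auto intro: p_cong_add p_cong_refl p_integral_intros)

lemma p_cong_scale:
  assumes "a \<approx> b (p^m)"
  shows "of_nat p ^ l * a \<approx> of_nat p ^ l * b (p^(l + m))"
proof -
  obtain u where "a = b + of_nat p ^ m * u" "p_integral u" "p_integral b"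
    using assms by (meson p_congE)
  then show ?thesis
    by (intro p_congI[of _ _ _ u]) (auto simp: algebra_simps power_add intro!: p_integral_intros)
qed

lemma p_cong_0: "p_integral a \<Longrightarrow> of_nat p ^ m * a \<approx> 0 (p^m)"
  by (rule p_congI[of _ _ _ a]) (auto intro: p_integral_intros)

text \<open>
  To first order a product is a sum. Both the binomial coefficients \<open>C(p-1,k)\<close> and the Apery
  summands have this shape, with \<open>m = 1\<close> and \<open>m = 2\<close> respectively.
\<close>

lemma prod_one_plus_cong:
  assumes "finite I" "\<And>i. i \<in> I \<Longrightarrow> p_integral (x i)"
  shows "(\<Prod>i\<in>I. 1 + of_nat p ^ m * x i) \<approx> 1 + of_nat p ^ m * (\<Sum>i\<in>I. x i) (p^(2 * m))"
  using assms
proof (induction I)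
  case empty
  then show ?case by (auto intro: p_cong_refl p_integral_intros)
next
  case (insert i I)
  have "(\<Prod>i\<in>insert i I. 1 + of_nat p ^ m * x i)
      \<approx> (1 + of_nat p ^ m * x i) * (1 + of_nat p ^ m * (\<Sum>i\<in>I. x i)) (p^(2 * m))"
    using insert by (auto intro!: p_cong_mult_left p_integral_intros)
  also have "(1 + of_nat p ^ m * x i) * (1 + of_nat p ^ m * (\<Sum>i\<in>I. x i))
      \<approx> 1 + of_nat p ^ m * (\<Sum>i\<in>insert i I. x i) (p^(2 * m))"
    using insert
    by (intro p_congI[of _ _ _ "x i * (\<Sum>i\<in>I. x i)"])
       (auto intro!: p_integral_intros simp: algebra_simps power_add mult_2_right)
  finally show ?case .
qed

lemma p_cong_weaken:
  assumes "a \<approx> b (p^m)" "l \<le> m"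
  shows "a \<approx> b (p^l)"
proof -
  obtain c where c: "a = b + of_nat p ^ m * c" "p_integral b" "p_integral c"
    using assms(1) by (rule p_congE)
  have "a = b + of_nat p ^ l * (of_nat p ^ (m - l) * c)"
    using assms(2) c(1) by (simp add: power_add[symmetric])
  then show ?thesis
    by (rule p_congI) (intro p_integral_intros c)+
qed

lemma prime_ge_5:
  assumes "p > 3"
  shows "p \<ge> 5"
proof -
  have "p \<noteq> 4"
    using prime_p by (auto simp: prime_nat_numeral_eq)
  then show ?thesis
    using assms by simp
qed

end

section \<open>Bernoulli numbers and power sums\<close>

lemma sum_binomial_bernoulli:
  "(\<Sum>i<n. of_nat (n choose i) * bernoulli i) = (if n = 1 then 1 else 0)"
proof (cases "n \<ge> 2")
  case True
  then have "{0..n - 1} = {..<n}" by auto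
  then show ?thesis using bernoulli_recurrence[OF True] True by simp
next
  case False
  then have "n = 0 \<or> n = 1" by auto
  then show ?thesis by (auto simp: bernoulli_0)
qed

text \<open>
  The sums are the Bernoulli polynomial \<open>B\<^sub>m\<close> at \<open>x + 1\<close> and at \<open>x\<close>. Expand the powers of \<open>x + 1\<close> and
  collect the coefficient of \<open>x^l\<close>: since \<open>C(m,i) C(m-i,l) = C(m,l) C(m-l,i)\<close>, it is a multiple of the
  sum in the recurrence of the Bernoulli numbers, so only \<open>l = m - 1\<close> survives.
\<close>

lemma bernoulli_polynomial_difference:
  fixes x :: rat
  shows "(\<Sum>i\<le>m. of_nat (m choose i) * bernoulli i * (x + 1) ^ (m - i))
    - (\<Sum>i\<le>m. of_nat (m choose i) * bernoulli i * x ^ (m - i)) = of_nat m * x ^ (m - 1)"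
proof -
  define c where "c = (\<lambda>i l. of_nat (m choose i) * bernoulli i * of_nat (m - i choose l) * x ^ l)"
  have *: "(x + 1) ^ n - x ^ n = (\<Sum>l<n. of_nat (n choose l) * x ^ l)" for n
    by (simp add: binomial_ring flip: lessThan_Suc_atMost)
  have "(\<Sum>i\<le>m. of_nat (m choose i) * bernoulli i * (x + 1) ^ (m - i))
    - (\<Sum>i\<le>m. of_nat (m choose i) * bernoulli i * x ^ (m - i))
    = (\<Sum>i\<le>m. of_nat (m choose i) * bernoulli i * ((x + 1) ^ (m - i) - x ^ (m - i)))"
    by (simp add: sum_subtractf algebra_simps)
  also have "\<dots> = (\<Sum>i\<le>m. \<Sum>l<m - i. c i l)"
    unfolding * by (simp add: c_def sum_distrib_left mult_ac)
  also have "\<dots> = (\<Sum>i\<in>{..m}. \<Sum>l\<in>{l \<in> {..m}. l < m - i}. c i l)"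
    by (intro sum.cong) auto
  also have "\<dots> = (\<Sum>l\<in>{..m}. \<Sum>i\<in>{i \<in> {..m}. l < m - i}. c i l)"
    by (rule sum.swap_restrict) auto
  also have "\<dots> = (\<Sum>l\<le>m. \<Sum>i<m - l. c i l)"
    by (intro sum.cong) auto
  also have "\<dots> = (\<Sum>l\<le>m. of_nat (m choose l) * x ^ l * (\<Sum>i<m - l. of_nat (m - l choose i) * bernoulli i))"
  proof (intro sum.cong refl)
    fix l assume "l \<in> {..m}"
    have "c i l = of_nat (m choose l) * x ^ l * (of_nat (m - l choose i) * bernoulli i)" if "i < m - l" for i
    proof -
      have "(m choose i) * (m - i choose l) = (m choose l) * (m - l choose i)"
        using that choose_mult[of i "i + l" m] choose_mult[of l "i + l" m]
        by (simp add: add.commute binomial_symmetric[of i "i + l"])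
      then have "(of_nat (m choose i) * of_nat (m - i choose l) :: rat) = of_nat (m choose l) * of_nat (m - l choose i)"
        by (metis of_nat_mult)
      then show ?thesis
        unfolding c_def by (simp add: mult_ac)
    qed
    then show "(\<Sum>i<m - l. c i l) = of_nat (m choose l) * x ^ l * (\<Sum>i<m - l. of_nat (m - l choose i) * bernoulli i)"
      by (simp add: sum_distrib_left)
  qed
  also have "\<dots> = (\<Sum>l\<le>m. if l = m - 1 then of_nat m * x ^ (m - 1) else 0)"
    by (intro sum.cong refl, cases m) (auto simp: sum_binomial_bernoulli)
  also have "\<dots> = of_nat m * x ^ (m - 1)"
    by simp
  finally show ?thesis .
qed

lemma faulhaber:
  "of_nat (Suc m) * (\<Sum>j<k. of_nat j ^ m) = (\<Sum>i\<le>m. of_nat (Suc m choose i) * bernoulli i * of_nat k ^ (Suc m - i))"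
proof (induction k)
  case 0
  show ?case by (simp add: sum.neutral power_0_left)
next
  case (Suc k)
  have "of_nat (Suc m) * of_nat k ^ m 
    = (\<Sum>i\<le>m. of_nat (Suc m choose i) * bernoulli i * of_nat (Suc k) ^ (Suc m - i))
    - (\<Sum>i\<le>m. of_nat (Suc m choose i) * bernoulli i * of_nat k ^ (Suc m - i))"
    using bernoulli_polynomial_difference[of "Suc m" "of_nat k"]
    by (simp add: add.commute del: binomial_Suc_Suc)
  then show ?case using Suc
    by (simp add: algebra_simps del: binomial_Suc_Suc)
qed

context prime_modulus
begin

text \<open>
  The recurrence for \<open>B\<^sub>n\<close> divides by \<open>n + 1\<close> only, which is less than \<open>p\<close>.
\<close>

lemma p_integral_bernoulli:
  assumes "n < p - 1"
  shows "p_integral (bernoulli n)"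
  using assms
proof (induction n rule: less_induct)
  case (less n)
  show ?case
  proof (cases "n = 0")
    case True
    then show ?thesis by (simp add: bernoulli_0 p_integral_intros)
  next
    case False
    then show ?thesis
      using less by (subst bernoulli.simps) (auto intro!: p_integral_intros simp del: of_nat_Suc)
  qed
qed

lemma fermat_p_cong:
  assumes "0 < k" "k < p"
  shows "of_nat k ^ (p - 1) \<approx> 1 (p^1)"
proof -
  have "[k ^ (p - 1) = 1] (mod p)"
    using assms by (intro fermat_theorem prime_p) (auto dest: nat_dvd_not_less)
  then have "[int (k ^ (p - 1)) = int 1] (mod int p)"
    by (simp only: cong_int_iff)
  then have "int p dvd int (k ^ (p - 1)) - int 1"
    by (simp only: cong_iff_dvd_diff)
  then obtain c where "int (k ^ (p - 1)) - int 1 = int p * c"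
    by (rule dvdE)
  then have "of_int (int (k ^ (p - 1)) - int 1) = (of_int (int p * c) :: rat)"
    by (rule arg_cong)
  then have "of_nat k ^ (p - 1) = 1 + of_nat p ^ 1 * (of_int c :: rat)"
    by simp
  then show ?thesis
    by (rule p_congI) (intro p_integral_intros)+
qed

lemma inverse_power_p_cong:
  assumes "0 < k" "k < p" "t \<le> p - 1"
  shows "1 / of_nat k ^ t \<approx> of_nat k ^ (p - 1 - t) (p^1)"
proof -
  have "1 / of_nat k ^ t * of_nat k ^ (p - 1) \<approx> 1 / of_nat k ^ t * 1 (p^1)"
    using assms by (intro p_cong_mult_left fermat_p_cong) (auto intro: p_integral_intros)
  moreover have "1 / of_nat k ^ t * of_nat k ^ (p - 1) = (of_nat k ^ (p - 1 - t) :: rat)"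
    using assms by (simp add: power_diff)
  ultimately show ?thesis
    by (auto intro: p_cong_sym)
qed

text \<open>
  For \<open>t > 0\<close> every term of Faulhaber's formula at \<open>p\<close> contains a factor \<open>p\<close>, and all the
  denominators are prime to \<open>p\<close>. For \<open>t = 0\<close> there are \<open>p - 1\<close> summands \<open>1\<close>.
\<close>

lemma power_sum_p_cong:
  assumes "t < p - 1"
  shows "(\<Sum>k\<in>{1..<p}. of_nat k ^ t) \<approx> (if t = 0 then - 1 else 0) (p^1)"
proof (cases "t = 0")
  case True
  have "1 \<le> p" using prime_gt_0_nat[OF prime_p] by simp
  then show ?thesis
    using True by (intro p_congI[of _ _ _ 1]) (auto intro: p_integral_intros simp: of_nat_diff)
next
  case False
  define c where "c = (\<Sum>i\<le>t. of_nat (Suc t choose i) * bernoulli i * of_nat p ^ (t - i))"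
  have "of_nat (Suc t) * (\<Sum>k<p. of_nat k ^ t) = of_nat p * c"
    unfolding faulhaber unfolding c_def sum_distrib_left
    by (intro sum.cong) (auto simp: Suc_diff_le simp del: binomial_Suc_Suc)
  moreover have "(\<Sum>k<p. of_nat k ^ t) = (\<Sum>k\<in>{1..<p}. of_nat k ^ t :: rat)"
    using False by (intro sum.mono_neutral_right) (auto simp: not_le)
  ultimately have "(\<Sum>k\<in>{1..<p}. of_nat k ^ t) = of_nat p ^ 1 * (c / of_nat (Suc t))"
    by (simp add: field_simps del: of_nat_Suc)
  moreover have "p_integral (c / of_nat (Suc t))"
    using assms unfolding c_def by (intro p_integral_intros p_integral_bernoulli) auto
  ultimately show ?thesis
    using False p_cong_0[of "c / of_nat (Suc t)" 1] by (simp only: if_False)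
qed

end

section \<open>Harmonic sums\<close>

text \<open>
  The upper bound is excluded: the \<open>n\<close>-th harmonic number is \<open>harmonic_sum 1 (Suc n)\<close>.
\<close>

definition harmonic_sum :: "nat \<Rightarrow> nat \<Rightarrow> rat" where
  "harmonic_sum t n = (\<Sum>k\<in>{1..<n}. 1 / of_nat k ^ t)"

lemma harmonic_sum_Suc: "1 \<le> n \<Longrightarrow> harmonic_sum t (Suc n) = harmonic_sum t n + 1 / of_nat n ^ t"
  by (simp add: harmonic_sum_def)

text \<open>
  The square of the sum of all \<open>1/k\<close> is twice the sum over pairs \<open>j \<le> k\<close> with the diagonal subtracted.
\<close>

lemma sum_harmonic_sum_over:
  "2 * (\<Sum>k\<in>{1..<n}. harmonic_sum 1 (Suc k) / of_nat k) = (harmonic_sum 1 n)\<^sup>2 + harmonic_sum 2 n"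
proof (induction n)
  case 0
  show ?case by (simp add: harmonic_sum_def)
next
  case (Suc n)
  show ?case
  proof (cases "n = 0")
    case True
    then show ?thesis by (simp add: harmonic_sum_def)
  next
    case False
    then have "2 * (\<Sum>k\<in>{1..<Suc n}. harmonic_sum 1 (Suc k) / of_nat k)
      = (harmonic_sum 1 n)\<^sup>2 + harmonic_sum 2 n + 2 * harmonic_sum 1 (Suc n) / of_nat n"
      using Suc by simp
    then show ?thesis
      using False by (simp add: harmonic_sum_Suc field_simps power2_eq_square)
  qed
qed

text \<open>
  Pascal's rule splits off \<open>C(n,k)/(k+1)\<close>, which is \<open>C(n+1,k+1)/(n+1)\<close>; this lowers the exponent by
  one. Starting from the vanishing alternating sum, two applications lead to the harmonic numbers
  and then to the sum of \<open>H\<^sub>k/k\<close>.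
\<close>

lemma binomial_power_sum_Suc:
  fixes S :: "nat \<Rightarrow> nat \<Rightarrow> rat"
  defines "S \<equiv> \<lambda>t n. \<Sum>k<n. (- 1) ^ k * of_nat (n choose Suc k) / of_nat (Suc k) ^ t"
  shows "S (Suc t) (Suc n) = S (Suc t) n + S t (Suc n) / of_nat (Suc n)"
proof -
  have *: "(of_nat (Suc n choose Suc k) :: rat) / of_nat (Suc k) ^ Suc t
    = of_nat (n choose Suc k) / of_nat (Suc k) ^ Suc t + of_nat (Suc n choose Suc k) / of_nat (Suc k) ^ t / of_nat (Suc n)" for k
  proof -
    have "of_nat (Suc n) * of_nat (n choose k) = (of_nat (Suc n choose Suc k) * of_nat (Suc k) :: rat)"
      by (metis Suc_times_binomial_eq of_nat_mult)
    then have "(of_nat (n choose k) :: rat) / of_nat (Suc k) = of_nat (Suc n choose Suc k) / of_nat (Suc n)"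
      by (simp add: field_simps del: of_nat_Suc binomial_Suc_Suc)
    then have "(of_nat (n choose k) :: rat) / of_nat (Suc k) ^ Suc t = of_nat (Suc n choose Suc k) / of_nat (Suc k) ^ t / of_nat (Suc n)"
      unfolding power_Suc divide_divide_eq_left[symmetric] by (simp only: divide_divide_eq_left mult.commute)
    then show ?thesis
      by (subst binomial_Suc_Suc) (simp add: add_divide_distrib del: of_nat_Suc binomial_Suc_Suc power_Suc)
  qed
  have "S (Suc t) (Suc n) = (\<Sum>k<Suc n. (- 1) ^ k * (of_nat (n choose Suc k) / of_nat (Suc k) ^ Suc t + of_nat (Suc n choose Suc k) / of_nat (Suc k) ^ t / of_nat (Suc n)))"
    unfolding S_def *[symmetric] by simp
  also have "\<dots> = (\<Sum>k<Suc n. (- 1) ^ k * of_nat (n choose Suc k) / of_nat (Suc k) ^ Suc t) + S t (Suc n) / of_nat (Suc n)"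
    by (simp add: S_def sum.distrib distrib_left sum_divide_distrib del: sum.lessThan_Suc of_nat_Suc binomial_Suc_Suc power_Suc)
  also have "(\<Sum>k<Suc n. (- 1) ^ k * of_nat (n choose Suc k) / of_nat (Suc k) ^ Suc t) = S (Suc t) n"
    by (simp add: S_def binomial_eq_0)
  finally show ?thesis .
qed

lemma binomial_sum_eq_harmonic:
  "(\<Sum>k<n. (- 1) ^ k * of_nat (n choose Suc k) / of_nat (Suc k) ^ 1) = harmonic_sum 1 (Suc n)"
proof (induction n)
  case 0
  show ?case by (simp add: harmonic_sum_def)
next
  case (Suc n)
  have "(\<Sum>i\<le>Suc n. (- 1) ^ i * of_nat (Suc n choose i)) = (0 :: rat)"
    by (rule choose_alternating_sum) simp
  then have "(\<Sum>k<Suc n. (- 1) ^ k * of_nat (Suc n choose Suc k) / of_nat (Suc k) ^ 0) = (1 :: rat)"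
    by (subst (asm) sum.atMost_shift)
       (simp add: sum_negf del: sum.lessThan_Suc binomial_Suc_Suc)
  then show ?case
    using binomial_power_sum_Suc[where t = 0 and n = n] Suc
    by (simp add: harmonic_sum_Suc del: sum.lessThan_Suc binomial_Suc_Suc of_nat_Suc)
qed

lemma binomial_sum_squares_eq_harmonic:
  "(\<Sum>k<n. (- 1) ^ k * of_nat (n choose Suc k) / of_nat (Suc k) ^ 2)
    = (\<Sum>k\<in>{1..<Suc n}. harmonic_sum 1 (Suc k) / of_nat k)"
proof (induction n)
  case 0
  show ?case by simp
next
  case (Suc n)
  then show ?case
    using binomial_power_sum_Suc[where t = 1 and n = n] binomial_sum_eq_harmonic[of "Suc n"]
    by (simp add: numeral_2_eq_2 del: sum.lessThan_Suc binomial_Suc_Suc of_nat_Suc)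
qed

lemma binomial_alternating_eq_prod:
  "(- 1) ^ k * of_nat (n choose k) = (\<Prod>j\<in>{1..<Suc k}. 1 - of_nat (Suc n) / (of_nat j :: rat))"
proof (induction k)
  case 0
  show ?case by simp
next
  case (Suc k)
  have "of_nat (Suc k) * of_nat (n choose Suc k) = (of_nat n - of_nat k) * (of_nat (n choose k) :: rat)"
  proof (cases "k \<le> n")
    case True
    have "Suc k * (n choose Suc k) = (n - k) * (n choose k)"
      by (simp only: binomial_absorption binomial_absorb_comp)
    then show ?thesis
      using True by (metis of_nat_diff of_nat_mult)
  qed (simp add: binomial_eq_0)
  then have *: "(of_nat (n choose Suc k) :: rat) = (of_nat n - of_nat k) / of_nat (Suc k) * of_nat (n choose k)"
    by (simp add: field_simps del: of_nat_Suc)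
  have "(- 1) ^ Suc k * of_nat (n choose Suc k) = (1 - of_nat (Suc n) / of_nat (Suc k)) * ((- 1) ^ k * of_nat (n choose k) :: rat)"
    unfolding * by (simp add: field_simps)
  then show ?case
    unfolding Suc by (simp add: mult.commute)
qed

context prime_modulus
begin

lemma p_integral_harmonic_sum: "n \<le> p \<Longrightarrow> p_integral (harmonic_sum t n)"
  by (auto simp: harmonic_sum_def intro!: p_integral_intros)

lemma harmonic_sum_p_cong_0:
  assumes "0 < t" "t < p - 1"
  shows "harmonic_sum t p \<approx> 0 (p^1)"
proof -
  have "harmonic_sum t p \<approx> (\<Sum>k\<in>{1..<p}. of_nat k ^ (p - 1 - t)) (p^1)"
    unfolding harmonic_sum_def using assms by (intro p_cong_sum inverse_power_p_cong) auto
  also have "\<dots> \<approx> 0 (p^1)"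
  proof -
    have "p - 1 - t < p - 1" "p - 1 - t \<noteq> 0" using assms by linarith+
    then show ?thesis using power_sum_p_cong[of "p - 1 - t"] by simp
  qed
  finally show ?thesis .
qed

text \<open>
  Modulo \<open>p\<close>, Fermat and Faulhaber turn the harmonic number into a polynomial in \<open>k\<close> of degree
  \<open>p - 1\<close> without constant term. Divided by \<open>k^2\<close>, its monomials have exponents from \<open>-1\<close> to
  \<open>p - 3\<close>; of these only the exponent \<open>0\<close> has a nonzero power sum, and its coefficient contains
  \<open>B\<^sub>p\<^sub>-\<^sub>3\<close>.
\<close>

lemma harmonic_convolution_p_cong:
  assumes "p > 3"
  shows "(\<Sum>k\<in>{1..<p}. harmonic_sum 1 k / of_nat k ^ 2) \<approx> bernoulli (p - 3) (p^1)"
proof -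
  define c where "c = (\<lambda>i. of_nat (p - 1 choose i) * bernoulli i / of_nat (p - 1))"
  have c: "p_integral (c i)" if "i \<le> p - 2" for i
    unfolding c_def using that assms by (intro p_integral_intros p_integral_bernoulli) auto
  have harmonic: "harmonic_sum 1 k \<approx> (\<Sum>i\<le>p - 2. c i * of_nat k ^ (p - 1 - i)) (p^1)" if "k < p" for k
  proof -
    have "harmonic_sum 1 k \<approx> (\<Sum>j\<in>{1..<k}. of_nat j ^ (p - 1 - 1)) (p^1)"
      unfolding harmonic_sum_def using that assms by (intro p_cong_sum inverse_power_p_cong) auto
    also have "(\<Sum>j\<in>{1..<k}. of_nat j ^ (p - 1 - 1)) = (\<Sum>j<k. of_nat j ^ (p - 2) :: rat)"
      using assms by (intro sum.mono_neutral_cong_left) (auto simp: not_le numeral_2_eq_2)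
    also have "\<dots> = (\<Sum>i\<le>p - 2. c i * of_nat k ^ (p - 1 - i))"
    proof -
      have "Suc (p - 2) = p - 1" using assms by simp
      then have "of_nat (p - 1) * (\<Sum>j<k. of_nat j ^ (p - 2)) = (\<Sum>i\<le>p - 2. of_nat (p - 1 choose i) * bernoulli i * of_nat k ^ (p - 1 - i))"
        using faulhaber[of "p - 2" k] by simp
      also have "\<dots> = of_nat (p - 1) * (\<Sum>i\<le>p - 2. c i * of_nat k ^ (p - 1 - i))"
        using assms by (simp add: c_def sum_distrib_left)
      finally show ?thesis
        using assms by simp
    qed
    finally show ?thesis .
  qed
  \<comment> \<open>The exponent \<open>-1\<close>, at \<open>i = p - 2\<close>, is a harmonic sum and not a power sum.\<close>
  have power_sum: "(\<Sum>k\<in>{1..<p}. of_nat k ^ (p - 1 - i) / of_nat k ^ 2) \<approx> (if i = p - 3 then - 1 else 0) (p^1)"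
    if "i \<le> p - 2" for i
  proof (cases "i = p - 2")
    case True
    then have "p - 1 - i = 1" using assms by simp
    then have "(\<Sum>k\<in>{1..<p}. of_nat k ^ (p - 1 - i) / of_nat k ^ 2) = harmonic_sum 1 p"
      by (simp add: harmonic_sum_def power2_eq_square)
    moreover have "i \<noteq> p - 3" "1 < p - 1" using True assms by linarith+
    ultimately show ?thesis
      using harmonic_sum_p_cong_0[of 1] by simp
  next
    case False
    then have i: "i \<le> p - 3" using that by simp
    have "p - 1 - i = (p - 3 - i) + 2" using i assms by simp
    then have *: "(\<Sum>k\<in>{1..<p}. of_nat k ^ (p - 1 - i) / of_nat k ^ 2) = (\<Sum>k\<in>{1..<p}. of_nat k ^ (p - 3 - i) :: rat)"
      by (intro sum.cong) (simp_all only: power_add, simp)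
    show ?thesis
    proof (cases "i = p - 3")
      case True
      then show ?thesis
        using * power_sum_p_cong[of 0] assms by simp
    next
      case False
      then have "p - 3 - i < p - 1" "p - 3 - i \<noteq> 0" using i assms by linarith+
      then show ?thesis
        using * False power_sum_p_cong[of "p - 3 - i"] by simp
    qed
  qed
  have "(\<Sum>k\<in>{1..<p}. harmonic_sum 1 k * (1 / of_nat k ^ 2))
      \<approx> (\<Sum>k\<in>{1..<p}. (\<Sum>i\<le>p - 2. c i * of_nat k ^ (p - 1 - i)) * (1 / of_nat k ^ 2)) (p^1)"
    by (intro p_cong_sum p_cong_mult_right harmonic p_integral_intros) auto
  then have "(\<Sum>k\<in>{1..<p}. harmonic_sum 1 k / of_nat k ^ 2)
      \<approx> (\<Sum>k\<in>{1..<p}. (\<Sum>i\<le>p - 2. c i * of_nat k ^ (p - 1 - i)) * (1 / of_nat k ^ 2)) (p^1)"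
    by simp
  also have "(\<Sum>k\<in>{1..<p}. (\<Sum>i\<le>p - 2. c i * of_nat k ^ (p - 1 - i)) * (1 / of_nat k ^ 2))
      = (\<Sum>i\<le>p - 2. c i * (\<Sum>k\<in>{1..<p}. of_nat k ^ (p - 1 - i) / of_nat k ^ 2))"
    unfolding sum_distrib_right sum_distrib_left by (subst sum.swap) (simp add: mult.assoc)
  also have "\<dots> \<approx> (\<Sum>i\<le>p - 2. c i * (if i = p - 3 then - 1 else 0)) (p^1)"
    by (intro p_cong_sum p_cong_mult_left power_sum c) auto
  also have "(\<Sum>i\<le>p - 2. c i * (if i = p - 3 then - 1 else 0)) = (\<Sum>i\<le>p - 2. if i = p - 3 then - c (p - 3) else 0)"
    by (intro sum.cong) auto
  also have "\<dots> = - c (p - 3)"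
    using assms by (subst sum.delta) auto
  \<comment> \<open>The coefficient is \<open>C(p-1,2)/(p-1) = (p-2)/2\<close>, which is \<open>-1\<close> modulo \<open>p\<close>.\<close>
  also have "- c (p - 3) \<approx> bernoulli (p - 3) (p^1)"
  proof (rule p_congI)
    obtain q where q: "p = q + 3"
      using assms by (metis add.commute le_Suc_ex less_imp_le)
    have "(q + 2 choose q) = (q + 2 choose 2)"
      by (subst binomial_symmetric) auto
    then have "2 * (q + 2 choose q) = (q + 2) * (q + 1)"
      by (simp add: choose_two)
    then have "2 * of_nat (q + 2 choose q) = (of_nat (q + 2) * of_nat (q + 1) :: rat)"
      by (metis of_nat_mult of_nat_numeral)
    then have *: "of_nat (q + 2 choose q) = (of_nat (q + 2) * of_nat (q + 1) / 2 :: rat)"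
      by simp
    have "p - 1 = q + 2" "p - 3 = q" using q by auto
    then have "c (p - 3) = of_nat (q + 2) * of_nat (q + 1) / 2 * bernoulli q / of_nat (q + 2)"
      unfolding c_def by (simp only: *)
    then have "c (p - 3) = of_nat (q + 1) / 2 * bernoulli (p - 3)"
      using \<open>p - 3 = q\<close> by (simp add: field_simps del: of_nat_add of_nat_Suc)
    then show "- c (p - 3) = bernoulli (p - 3) + of_nat p ^ 1 * (- bernoulli (p - 3) / of_nat 2)"
      by (simp add: q field_simps)
  qed (use assms in \<open>auto intro!: p_integral_intros p_integral_bernoulli simp del: of_nat_numeral\<close>)
  finally show ?thesis .
qed

lemma binomial_p_cong:
  assumes "k < p"
  shows "(- 1) ^ k * of_nat (p - 1 choose k) \<approx> 1 - of_nat p * harmonic_sum 1 (Suc k) (p^2)"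
proof -
  have "Suc (p - 1) = p" using assms by simp
  then have "(- 1) ^ k * of_nat (p - 1 choose k) = (\<Prod>j\<in>{1..<Suc k}. 1 + of_nat p ^ 1 * (- 1 / of_nat j :: rat))"
    unfolding binomial_alternating_eq_prod by simp
  also have "\<dots> \<approx> 1 + of_nat p ^ 1 * (\<Sum>j\<in>{1..<Suc k}. - 1 / of_nat j) (p^(2 * 1))"
    using assms by (intro prod_one_plus_cong) (auto intro!: p_integral_intros)
  also have "1 + of_nat p ^ 1 * (\<Sum>j\<in>{1..<Suc k}. - 1 / of_nat j) = 1 - of_nat p * harmonic_sum 1 (Suc k)"
    by (simp add: harmonic_sum_def sum_negf)
  finally show ?thesis by simp
qed

text \<open>
  Let \<open>E\<close> be the sum of \<open>H\<^sub>k/k\<close>. Twice \<open>E\<close> is the second harmonic sum up to the square of the first,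
  which is \<open>0\<close> modulo \<open>p^2\<close>. As an alternating binomial sum, \<open>E\<close> is \<open>p T\<close> minus the second harmonic
  sum. Comparison determines the second harmonic sum from \<open>T\<close> modulo \<open>p\<close>.
\<close>

lemma harmonic_sum_2_p_cong:
  assumes "p > 3"
  shows "harmonic_sum 2 p \<approx> 2 / 3 * of_nat p * bernoulli (p - 3) (p^2)"
proof -
  define T where "T = (\<Sum>k\<in>{1..<p}. harmonic_sum 1 (Suc k) / of_nat k ^ 2)"
  define E where "E = (\<Sum>k\<in>{1..<p}. harmonic_sum 1 (Suc k) / of_nat k)"
  define B where "B = bernoulli (p - 3)"
  have "p \<ge> 5"
    using assms by (rule prime_ge_5)
  have B: "p_integral B"
    using assms by (auto simp: B_def intro: p_integral_bernoulli)
  have H: "p_integral (harmonic_sum t p)" for t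
    by (rule p_integral_harmonic_sum) simp
  have "T = (\<Sum>k\<in>{1..<p}. harmonic_sum 1 k / of_nat k ^ 2) + harmonic_sum 3 p"
    unfolding T_def harmonic_sum_def[of 3] sum.distrib[symmetric]
    by (intro sum.cong) (auto simp: harmonic_sum_Suc add_divide_distrib power2_eq_square power3_eq_cube)
  also have "\<dots> \<approx> B + 0 (p^1)"
    unfolding B_def using \<open>p \<ge> 5\<close> by (intro p_cong_add harmonic_convolution_p_cong harmonic_sum_p_cong_0) auto
  finally have T: "T \<approx> B (p^1)" by simp
  \<comment> \<open>The factor \<open>p\<close> of the first harmonic sum is enough, because it enters squared.\<close>
  obtain c where c: "harmonic_sum 1 p = of_nat p * c" "p_integral c"
  proof (rule p_congE)
    show "harmonic_sum 1 p \<approx> 0 (p^1)"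
      using assms by (intro harmonic_sum_p_cong_0) auto
  qed auto
  have H1: "(harmonic_sum 1 p)\<^sup>2 \<approx> 0 (p^2)"
    unfolding c power_mult_distrib by (intro p_cong_0 p_integral_intros c)
  have E: "E \<approx> of_nat p * T - harmonic_sum 2 p (p^2)"
  proof -
    have "E = (\<Sum>k<p - 1. (- 1) ^ k * of_nat (p - 1 choose Suc k) / of_nat (Suc k) ^ 2)"
      unfolding binomial_sum_squares_eq_harmonic using assms by (simp add: E_def)
    also have "\<dots> = (\<Sum>k\<in>{1..<p}. - 1 / of_nat k ^ 2 * ((- 1) ^ k * of_nat (p - 1 choose k)))"
    proof -
      have "{1..<p} = {Suc 0..<Suc (p - 1)}" using assms by auto
      then show ?thesis
        by (simp only: sum.shift_bounds_Suc_ivl) (simp add: atLeast0LessThan)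
    qed
    also have "\<dots> \<approx> (\<Sum>k\<in>{1..<p}. - 1 / of_nat k ^ 2 * (1 - of_nat p * harmonic_sum 1 (Suc k))) (p^2)"
      by (intro p_cong_sum p_cong_mult_left binomial_p_cong) (auto intro!: p_integral_intros)
    also have "\<dots> = of_nat p * T - harmonic_sum 2 p"
      unfolding T_def harmonic_sum_def[of 2] sum_distrib_left sum_subtractf[symmetric]
      by (intro sum.cong refl) (simp add: diff_divide_distrib algebra_simps)
    finally show ?thesis .
  qed
  have "2 * E = (harmonic_sum 1 p)\<^sup>2 + harmonic_sum 2 p"
    unfolding E_def by (rule sum_harmonic_sum_over)
  moreover have "2 * (E + harmonic_sum 2 p) - (harmonic_sum 1 p)\<^sup>2
      \<approx> 2 * ((of_nat p * T - harmonic_sum 2 p) + harmonic_sum 2 p) - 0 (p^2)"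
    by (intro p_cong_diff p_cong_mult_left p_cong_add E H1 p_cong_refl H p_integral_intros)
  ultimately have "3 * harmonic_sum 2 p \<approx> 2 * (of_nat p * T) (p^2)"
    by (simp add: algebra_simps)
  moreover have "of_nat p * T \<approx> of_nat p * B (p^2)"
    using p_cong_scale[OF T, of 1] by (simp add: numeral_2_eq_2)
  then have "2 * (of_nat p * T) \<approx> 2 * (of_nat p * B) (p^2)"
    by (rule p_cong_mult_left[rotated]) (rule p_integral_intros)
  ultimately have "3 * harmonic_sum 2 p \<approx> 2 * (of_nat p * B) (p^2)"
    by (blast intro: p_cong_trans)
  then have "1 / of_nat 3 * (3 * harmonic_sum 2 p) \<approx> 1 / of_nat 3 * (2 * (of_nat p * B)) (p^2)"
    using assms by (intro p_cong_mult_left p_integral_inverse_of_nat) auto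
  then show ?thesis
    by (simp add: B_def mult_ac)
qed

end

section \<open>The two boundary Apery numbers\<close>

lemma apery_term_eq_prod:
  "apery_term n (Suc k) = of_nat n * (of_nat n + of_nat (Suc k)) / of_nat (Suc k) ^ 2
    * (\<Prod>j\<in>{1..<Suc k}. of_nat n ^ 2 / of_nat j ^ 2 - 1)"
proof (induction k)
  case 0
  show ?case by (simp add: apery_term_def)
next
  case (Suc k)
  have "apery_term n (Suc (Suc k)) = apery_term n (Suc k) * (of_nat n + of_nat (Suc k) + 1) * (of_nat n - of_nat (Suc k)) / of_nat (Suc (Suc k)) ^ 2"
    unfolding apery_term_Suc_right[of n "Suc k", symmetric] by simp
  then show ?case
    unfolding Suc by (simp add: field_simps power2_eq_square)
qed

text \<open>
  The same product as for \<open>n\<close> itself appears at \<open>n - 1\<close>, because \<open>C(n-1,k) C(n-1+k,k)\<close> arises from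
  \<open>C(n,k) C(n+k,k)\<close> by replacing the factor \<open>n + k\<close> with \<open>n - k\<close>.
\<close>

lemma apery_term_pred_eq_prod:
  assumes "1 \<le> n"
  shows "apery_term (n - 1) (Suc k) = of_nat n * (of_nat n - of_nat (Suc k)) / of_nat (Suc k) ^ 2
    * (\<Prod>j\<in>{1..<Suc k}. of_nat n ^ 2 / of_nat j ^ 2 - 1)"
proof (induction k)
  case 0
  show ?case using assms by (simp add: apery_term_def of_nat_diff)
next
  case (Suc k)
  have "apery_term (n - 1) (Suc (Suc k)) = apery_term (n - 1) (Suc k) * (of_nat n + of_nat (Suc k)) * (of_nat n - 1 - of_nat (Suc k)) / of_nat (Suc (Suc k)) ^ 2"
    using apery_term_Suc_right[of "n - 1" "Suc k"] assms by (simp add: of_nat_diff field_simps)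
  then show ?case
    unfolding Suc by (simp add: field_simps power2_eq_square)
qed

context prime_modulus
begin



definition apery_product :: "nat \<Rightarrow> rat" where
  "apery_product k = (\<Prod>j\<in>{1..<k}. of_nat p ^ 2 / of_nat j ^ 2 - 1)"

lemma apery_product_square_p_cong:
  assumes "k \<le> p"
  shows "(apery_product k)\<^sup>2 \<approx> 1 - 2 * of_nat p ^ 2 * harmonic_sum 2 k (p^4)"
proof -
  have "(apery_product k)\<^sup>2 = (\<Prod>j\<in>{1..<k}. 1 + of_nat p ^ 2 * (- 1 / of_nat j ^ 2))\<^sup>2"
    unfolding apery_product_def prod_power_distrib
    by (intro prod.cong) (auto simp: power2_eq_square algebra_simps)
  also have "\<dots> \<approx> (1 + of_nat p ^ 2 * (\<Sum>j\<in>{1..<k}. - 1 / of_nat j ^ 2))\<^sup>2 (p^(2 * 2))"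
    using assms by (intro p_cong_power prod_one_plus_cong) (auto intro!: p_integral_intros)
  also have "(1 + of_nat p ^ 2 * (\<Sum>j\<in>{1..<k}. - 1 / of_nat j ^ 2))\<^sup>2 \<approx> 1 - 2 * of_nat p ^ 2 * harmonic_sum 2 k (p^(2 * 2))"
    using assms
    by (intro p_congI[of _ _ _ "(harmonic_sum 2 k)\<^sup>2"] p_integral_intros p_integral_harmonic_sum)
       (simp_all add: harmonic_sum_def sum_negf power2_eq_square algebra_simps eval_nat_numeral)
  finally show ?thesis by simp
qed

text \<open>
  The sign \<open>e\<close> is \<open>1\<close> for the summands of \<open>A\<^sub>p\<close> and \<open>-1\<close> for those of \<open>A\<^sub>p\<^sub>-\<^sub>1\<close>. The
  factor \<open>p^2\<close> of the square makes it sufficient to know the rest modulo \<open>p^2\<close>, where the square of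
  the product is \<open>1\<close>.
\<close>

lemma apery_term_square_p_cong:
  assumes "0 < k" "k < p" and e: "e = 1 \<or> e = - 1"
    and t: "t = of_nat p * (of_nat p + e * of_nat k) / of_nat k ^ 2 * apery_product k"
  shows "t\<^sup>2 \<approx> of_nat p ^ 2 / of_nat k ^ 2 + e * (2 * of_nat p ^ 3) / of_nat k ^ 3 (p^4)"
proof -
  have e_int: "p_integral e"
    using e by (auto intro: p_integral_intros)
  define r where "r = (of_nat p + e * of_nat k) / of_nat k ^ 2"
  have r_int: "p_integral r"
    using assms(1,2) e_int unfolding r_def by (intro p_integral_intros)
  have "(apery_product k)\<^sup>2 \<approx> 1 (p^2)"
  proof -
    have "(apery_product k)\<^sup>2 \<approx> 1 - 2 * of_nat p ^ 2 * harmonic_sum 2 k (p^2)"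
      using assms by (intro p_cong_weaken[OF apery_product_square_p_cong]) auto
    also have "\<dots> \<approx> 1 (p^2)"
      using assms by (intro p_congI[of _ _ _ "- 2 * harmonic_sum 2 k"] p_integral_intros p_integral_harmonic_sum) auto
    finally show ?thesis .
  qed
  then have "r\<^sup>2 * (apery_product k)\<^sup>2 \<approx> r\<^sup>2 * 1 (p^2)"
    by (intro p_cong_mult_left p_integral_intros r_int)
  also have "r\<^sup>2 * 1 \<approx> 1 / of_nat k ^ 2 + e * (2 * of_nat p) / of_nat k ^ 3 (p^2)"
    using assms(1,2) e
    by (intro p_congI[of _ _ _ "1 / of_nat k ^ 4"] p_integral_intros e_int)
       (auto simp: r_def field_simps eval_nat_numeral)
  finally have "of_nat p ^ 2 * (r\<^sup>2 * (apery_product k)\<^sup>2)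
      \<approx> of_nat p ^ 2 * (1 / of_nat k ^ 2 + e * (2 * of_nat p) / of_nat k ^ 3) (p^(2 + 2))"
    by (rule p_cong_scale)
  moreover have "of_nat p ^ 2 * (r\<^sup>2 * (apery_product k)\<^sup>2) = t\<^sup>2"
    by (simp add: t r_def power_mult_distrib power_divide)
  moreover have "of_nat p ^ 2 * (1 / of_nat k ^ 2 + e * (2 * of_nat p) / of_nat k ^ 3)
      = of_nat p ^ 2 / of_nat k ^ 2 + e * (2 * of_nat p ^ 3) / of_nat k ^ 3"
    by (simp add: eval_nat_numeral algebra_simps)
  ultimately show ?thesis by simp
qed

lemma sum_apery_term_squares_p_cong:
  assumes "p > 3" and e: "e = 1 \<or> e = - 1"
    and t: "\<And>k. 0 < k \<Longrightarrow> t k = of_nat p * (of_nat p + e * of_nat k) / of_nat k ^ 2 * apery_product k"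
  shows "(\<Sum>k\<in>{1..<p}. (t k)\<^sup>2) \<approx> of_nat p ^ 2 * harmonic_sum 2 p (p^4)"
proof -
  have "p \<ge> 5"
    using assms(1) by (rule prime_ge_5)
  have "(\<Sum>k\<in>{1..<p}. (t k)\<^sup>2) \<approx> (\<Sum>k\<in>{1..<p}. of_nat p ^ 2 / of_nat k ^ 2 + e * (2 * of_nat p ^ 3) / of_nat k ^ 3) (p^4)"
    using e t by (intro p_cong_sum apery_term_square_p_cong) auto
  also have "(\<Sum>k\<in>{1..<p}. of_nat p ^ 2 / of_nat k ^ 2 + e * (2 * of_nat p ^ 3) / of_nat k ^ 3)
      = of_nat p ^ 2 * harmonic_sum 2 p + 2 * e * (of_nat p ^ 3 * harmonic_sum 3 p)"
    by (simp add: harmonic_sum_def sum.distrib sum_distrib_left mult_ac)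
  also have "\<dots> \<approx> of_nat p ^ 2 * harmonic_sum 2 p + 2 * e * (of_nat p ^ 3 * 0) (p^4)"
  proof -
    have "harmonic_sum 3 p \<approx> 0 (p^1)"
      using \<open>p \<ge> 5\<close> by (intro harmonic_sum_p_cong_0) auto
    then have "of_nat p ^ 3 * harmonic_sum 3 p \<approx> of_nat p ^ 3 * 0 (p^(3 + 1))"
      by (rule p_cong_scale)
    then have "of_nat p ^ 3 * harmonic_sum 3 p \<approx> of_nat p ^ 3 * 0 (p^4)"
      by simp
    moreover have "p_integral e"
      using e by (auto intro: p_integral_intros)
    ultimately show ?thesis
      by (intro p_cong_add[OF p_cong_refl p_cong_mult_left] p_integral_intros p_integral_harmonic_sum) auto
  qed
  finally show ?thesis by simp
qed

text \<open>
  The summand at \<open>k = 0\<close> is \<open>1\<close>, the one at \<open>k = p\<close> is the square of \<open>C(2p,p)\<close> and is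
  \<open>4 - 8 p^2 H\<close>; all the others together contribute \<open>p^2 H\<close>.
\<close>

lemma apery_p_cong:
  assumes "p > 3"
  shows "of_nat (apery p) \<approx> 5 - 7 * (of_nat p ^ 2 * harmonic_sum 2 p) (p^4)"
proof -
  have t: "apery_term p k = of_nat p * (of_nat p + 1 * of_nat k) / of_nat k ^ 2 * apery_product k" if "0 < k" for k
    using apery_term_eq_prod[of p "k - 1"] that by (simp add: apery_product_def)
  have "{..p} = insert 0 (insert p {1..<p})"
    using assms by auto
  then have "of_nat (apery p) = 1 + (apery_term p p)\<^sup>2 + (\<Sum>k\<in>{1..<p}. (apery_term p k)\<^sup>2)"
    using assms of_nat_apery[of p p] by (simp add: apery_term_0)
  moreover have "(apery_term p p)\<^sup>2 = 4 * (apery_product p)\<^sup>2"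
    using assms by (subst t) (auto simp: field_simps power2_eq_square)
  moreover have "1 + 4 * (apery_product p)\<^sup>2 + (\<Sum>k\<in>{1..<p}. (apery_term p k)\<^sup>2)
      \<approx> 1 + 4 * (1 - 2 * of_nat p ^ 2 * harmonic_sum 2 p) + of_nat p ^ 2 * harmonic_sum 2 p (p^4)"
    using assms t
    by (intro p_cong_add p_cong_mult_left apery_product_square_p_cong sum_apery_term_squares_p_cong[of 1] p_cong_refl p_integral_intros) auto
  ultimately show ?thesis by (simp add: algebra_simps)
qed

lemma apery_pred_p_cong:
  assumes "p > 3"
  shows "of_nat (apery (p - 1)) \<approx> 1 + of_nat p ^ 2 * harmonic_sum 2 p (p^4)"
proof -
  have t: "apery_term (p - 1) k = of_nat p * (of_nat p + (- 1) * of_nat k) / of_nat k ^ 2 * apery_product k" if "0 < k" for k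
    using apery_term_pred_eq_prod[of p "k - 1"] that assms by (simp add: apery_product_def)
  have "{..p - 1} = insert 0 {1..<p}"
    using assms by auto
  then have "of_nat (apery (p - 1)) = 1 + (\<Sum>k\<in>{1..<p}. (apery_term (p - 1) k)\<^sup>2)"
    using assms of_nat_apery[of "p - 1" "p - 1"] by (simp add: apery_term_0)
  moreover have "1 + (\<Sum>k\<in>{1..<p}. (apery_term (p - 1) k)\<^sup>2) \<approx> 1 + of_nat p ^ 2 * harmonic_sum 2 p (p^4)"
    using assms t
    by (intro p_cong_add sum_apery_term_squares_p_cong[of "- 1"] p_cong_refl p_integral_intros) auto
  ultimately show ?thesis by simp
qed

section \<open>The congruence\<close>

text \<open>
  The terms with \<open>p^6\<close> see \<open>a\<close> and \<open>b\<close> modulo \<open>p^2\<close> only, as \<open>5\<close> and \<open>1\<close>; the correction \<open>p^3 y\<close> enters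
  through \<open>4 p^4 a b\<close> alone.
\<close>

lemma weighted_sum_p_cong:
  fixes a b y :: rat
  assumes "p > 3" and y: "p_integral y"
    and a: "a \<approx> 5 - 7 * (of_nat p ^ 3 * y) (p^4)" and b: "b \<approx> 1 + of_nat p ^ 3 * y (p^4)"
  shows "of_nat p ^ 6 * (17 / 3 * a * b - (a\<^sup>2 + b\<^sup>2) / 6) - 4 * of_nat p ^ 4 * a * b
    \<approx> - 20 * of_nat p ^ 4 + 24 * of_nat p ^ 6 + 8 * of_nat p ^ 7 * y (p^8)"
proof -
  have "5 - 7 * (of_nat p ^ 3 * y) \<approx> 5 (p^2)"
    by (intro p_congI[of _ _ _ "- 7 * (of_nat p * y)"] p_integral_intros y) (simp add: eval_nat_numeral)
  then have a': "a \<approx> 5 (p^2)"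
    by (intro p_cong_trans[OF p_cong_weaken[OF a]]) auto
  have "1 + of_nat p ^ 3 * y \<approx> 1 (p^2)"
    by (intro p_congI[of _ _ _ "of_nat p * y"] p_integral_intros y) (simp add: eval_nat_numeral)
  then have b': "b \<approx> 1 (p^2)"
    by (intro p_cong_trans[OF p_cong_weaken[OF b]]) auto
  have inverses: "p_integral (17 / of_nat 3)" "p_integral (1 / (of_nat 2 * of_nat 3))"
    using assms(1) p_integral_mult[OF p_integral_inverse_of_nat[of 2] p_integral_inverse_of_nat[of 3]]
    by (auto intro!: p_integral_intros simp del: of_nat_numeral)
  have "17 / of_nat 3 * (a * b) - 1 / (of_nat 2 * of_nat 3) * (a\<^sup>2 + b\<^sup>2)
      \<approx> 17 / of_nat 3 * (5 * 1) - 1 / (of_nat 2 * of_nat 3) * (5\<^sup>2 + 1\<^sup>2) (p^2)"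
    by (intro p_cong_diff p_cong_mult_left p_cong_add p_cong_mult p_cong_power a' b' inverses)
  then have "of_nat p ^ 6 * (17 / of_nat 3 * (a * b) - 1 / (of_nat 2 * of_nat 3) * (a\<^sup>2 + b\<^sup>2))
      \<approx> of_nat p ^ 6 * (17 / of_nat 3 * (5 * 1) - 1 / (of_nat 2 * of_nat 3) * (5\<^sup>2 + 1\<^sup>2)) (p^(6 + 2))"
    by (rule p_cong_scale)
  then have 6: "of_nat p ^ 6 * (17 / 3 * a * b - (a\<^sup>2 + b\<^sup>2) / 6) \<approx> of_nat p ^ 6 * 24 (p^8)"
    by (simp add: mult_ac)
  have "4 * (a * b) \<approx> 4 * ((5 - 7 * (of_nat p ^ 3 * y)) * (1 + of_nat p ^ 3 * y)) (p^4)"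
    by (intro p_cong_mult_left p_cong_mult a b p_integral_intros)
  also have "4 * ((5 - 7 * (of_nat p ^ 3 * y)) * (1 + of_nat p ^ 3 * y)) \<approx> 20 - 8 * of_nat p ^ 3 * y (p^4)"
    by (intro p_congI[of _ _ _ "- 28 * of_nat p ^ 2 * y\<^sup>2"] p_integral_intros y)
       (simp add: eval_nat_numeral algebra_simps)
  finally have "of_nat p ^ 4 * (4 * (a * b)) \<approx> of_nat p ^ 4 * (20 - 8 * of_nat p ^ 3 * y) (p^(4 + 4))"
    by (rule p_cong_scale)
  then have "of_nat p ^ 6 * (17 / 3 * a * b - (a\<^sup>2 + b\<^sup>2) / 6) - of_nat p ^ 4 * (4 * (a * b))
      \<approx> of_nat p ^ 6 * 24 - of_nat p ^ 4 * (20 - 8 * of_nat p ^ 3 * y) (p^8)"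
    by (intro p_cong_diff 6) simp
  moreover have "of_nat p ^ 6 * 24 - of_nat p ^ 4 * (20 - 8 * of_nat p ^ 3 * y)
      = - 20 * of_nat p ^ 4 + 24 * of_nat p ^ 6 + 8 * of_nat p ^ 7 * y"
    by (simp add: eval_nat_numeral algebra_simps)
  moreover have "of_nat p ^ 4 * (4 * (a * b)) = 4 * of_nat p ^ 4 * a * b"
    by (simp add: mult_ac)
  ultimately show ?thesis by (simp only:)
qed

end

theorem theorem4p1:
  fixes p :: nat
  assumes "prime p" and "p > 3"
  shows "rat_cong_ppow p 8
    (\<Sum>n=0..p-1. (9 * (2 * of_nat n + 1) ^ 5 - 4 * (2 * of_nat n + 1) ^ 3 - (2 * of_nat n + 1))
        * of_nat (apery n) ^ 2)
    (- 20 * of_nat p ^ 4 + 24 * of_nat p ^ 6 + 16 / 3 * of_nat p ^ 7 * bernoulli (p - 3))"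
proof -
  interpret prime_modulus p
    by unfold_locales (rule assms)
  define y where "y = 2 / of_nat 3 * bernoulli (p - 3)"
  have y: "p_integral y"
    unfolding y_def using assms by (intro p_integral_intros p_integral_bernoulli) auto
  have "of_nat p ^ 2 * harmonic_sum 2 p \<approx> of_nat p ^ 2 * (of_nat p * y) (p^(2 + 2))"
    using harmonic_sum_2_p_cong[OF assms(2)] by (intro p_cong_scale) (simp add: y_def mult_ac)
  then have x: "of_nat p ^ 2 * harmonic_sum 2 p \<approx> of_nat p ^ 3 * y (p^4)"
    by (simp add: power2_eq_square power3_eq_cube mult.assoc)
  have a: "of_nat (apery p) \<approx> 5 - 7 * (of_nat p ^ 3 * y) (p^4)"
    by (rule p_cong_trans[OF apery_p_cong[OF assms(2)]])
       (intro p_cong_diff p_cong_mult_left x p_cong_refl p_integral_intros)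
  have b: "of_nat (apery (p - 1)) \<approx> 1 + of_nat p ^ 3 * y (p^4)"
    by (rule p_cong_trans[OF apery_pred_p_cong[OF assms(2)]])
       (intro p_cong_add x p_cong_refl p_integral_intros)
  have "{0..p - 1} = {..<p}"
    using assms by auto
  moreover have "8 * of_nat p ^ 7 * y = 16 / 3 * of_nat p ^ 7 * bernoulli (p - 3)"
    by (simp add: y_def)
  ultimately show ?thesis
    using weighted_sum_p_cong[OF assms(2) y a b] weighted_apery_square_sum[of p] by (simp only:)
qed

end
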